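(* Let $n\in\mathbb{N}$ and let $\mathcal{L}$ be a finite set of rectangular polyominoes such that at most one element of $\mathcal{L}$ has unit height, every other element of $\mathcal{L}$ has height $>n/2$, and the polyomino of unit height has width dividing the greatest common divisor of the widths of all the other polyominoes in $\mathcal{L}$. Then $\mathcal{L}$ is strongly $n$-Noetherian. Furthermore, $\beta_n(\mathcal{L})$ equals the largest width of any polyomino in $\mathcal{L}$.
   Context: A polyomino is a region of $\mathbb{R}^2$ made of unit squares joined along coincident edges, considered up to translation. $R_{n\times m}$ denotes the rectangular region of height $n$ and width $m$. A tiling of $R_{n\times m}$ by a multiset $T$ of polyominoes is a placement of translates of all elements of $T$ in $R_{n\times m}$ covering every point, with no two different elements having two-dimensional overlap; a tiling by elements of $\mathcal{L}$ is a tiling by a multiset with elements drawn from $\mathcal{L}$. A rearrangement of a tiling by $T$ is any tiling of $R_{n\times m}$ by the same multiset $T$. A tiling of $R_{n\times m}$ admits a subtiling if it has a rearrangement which is the side-by-side juxtaposition of a tiling of $R_{n\times m'}$ and a tiling of $R_{n\times m''}$ with $m=m'+m''$ and $m',m''\neq 0$. $\beta_n(\mathcal{L})$ is the smallest natural number such that every tiling of $R_{n\times m}$ by elements of $\mathcal{L}$ with $m>\beta_n(\mathcal{L})$ admits a subtiling; $\beta_n(\mathcal{L}):=\infty$ if there are tilings with $m$ arbitrarily large admitting no subtiling. $\mathcal{L}$ is called strongly $n$-Noetherian if $\beta_n(\mathcal{L})<\infty$.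
   Formalization: The formula for β_n(L) is stated with the largest width taken over elements of L that occur in some tiling of some R_{n×m} (and over all of L if a widest one occurs), since it fails otherwise, e.g. n=1 with a 1×1 and a height-2, width-5 rectangle; n≥1 is assumed. *)

theory Defs
  imports "HOL-Analysis.Analysis" "HOL-Library.Extended_Nat" "HOL-Library.Multiset"
begin

definition unit_square :: "int \<times> int \<Rightarrow> (real \<times> real) set" where
  "unit_square c = {real_of_int (fst c)..real_of_int (fst c) + 1} \<times>
                   {real_of_int (snd c)..real_of_int (snd c) + 1}"

definition edge_adjacent :: "int \<times> int \<Rightarrow> int \<times> int \<Rightarrow> bool" where
  "edge_adjacent c d \<longleftrightarrow> \<bar>fst c - fst d\<bar> + \<bar>snd c - snd d\<bar> = 1"

definition edge_connected :: "(int \<times> int) set \<Rightarrow> bool" where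
  "edge_connected C \<longleftrightarrow>
     (\<forall>c\<in>C. \<forall>d\<in>C. (c, d) \<in> {(a, b). a \<in> C \<and> b \<in> C \<and> edge_adjacent a b}\<^sup>*)"

text \<open>A region up to translation is represented by the set of all its (real) translates.  Hence
  the translates of a polyomino \<open>P\<close> in the plane are exactly the elements of \<open>P\<close>.\<close>

definition shape :: "(real \<times> real) set \<Rightarrow> (real \<times> real) set set" where
  "shape A = range (\<lambda>v. (+) v ` A)"

definition polyomino :: "(real \<times> real) set set \<Rightarrow> bool" where
  "polyomino P \<longleftrightarrow>
     (\<exists>C. finite C \<and> C \<noteq> {} \<and> edge_connected C \<and> P = shape (\<Union>c\<in>C. unit_square c))"

text \<open>The first argument is the height and the second one the width; the first coordinate of
  the plane is the horizontal one.\<close>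

definition rect :: "nat \<Rightarrow> nat \<Rightarrow> (real \<times> real) set" where
  "rect n m = {0..real m} \<times> {0..real n}"

definition rectangular :: "(real \<times> real) set set \<Rightarrow> bool" where
  "rectangular P \<longleftrightarrow> (\<exists>h w. h \<ge> 1 \<and> w \<ge> 1 \<and> P = shape (rect h w))"

text \<open>Height and width are only meaningful for rectangular polyominoes.\<close>

definition height :: "(real \<times> real) set set \<Rightarrow> nat" where
  "height P = (THE h. h \<ge> 1 \<and> (\<exists>w\<ge>1. P = shape (rect h w)))"

definition width :: "(real \<times> real) set set \<Rightarrow> nat" where
  "width P = (THE w. w \<ge> 1 \<and> (\<exists>h\<ge>1. P = shape (rect h w)))"

text \<open>A tiling is given by the set of its placed tiles.  No information is lost by using a set:
  two tiles placed at the same position would overlap.  The multiset of polyominoes used by the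
  tiling is recovered by \<open>tile_mset\<close>.\<close>

definition is_tiling :: "(real \<times> real) set \<Rightarrow> (real \<times> real) set set \<Rightarrow> bool" where
  "is_tiling R S \<longleftrightarrow>
     finite S \<and> (\<forall>A\<in>S. polyomino (shape A)) \<and> \<Union>S = R \<and>
     (\<forall>A\<in>S. \<forall>B\<in>S. A \<noteq> B \<longrightarrow> interior (A \<inter> B) = {})"

definition tile_mset :: "(real \<times> real) set set \<Rightarrow> (real \<times> real) set set multiset" where
  "tile_mset S = image_mset shape (mset_set S)"

definition tiling_by ::
  "(real \<times> real) set \<Rightarrow> (real \<times> real) set set multiset \<Rightarrow> (real \<times> real) set set \<Rightarrow> bool" where
  "tiling_by R T S \<longleftrightarrow> is_tiling R S \<and> tile_mset S = T"

definition tiling_from ::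
  "(real \<times> real) set \<Rightarrow> (real \<times> real) set set set \<Rightarrow> (real \<times> real) set set \<Rightarrow> bool" where
  "tiling_from R \<L> S \<longleftrightarrow> (\<exists>T. set_mset T \<subseteq> \<L> \<and> tiling_by R T S)"

definition rearrangement ::
  "(real \<times> real) set \<Rightarrow> (real \<times> real) set set \<Rightarrow> (real \<times> real) set set \<Rightarrow> bool" where
  "rearrangement R S S' \<longleftrightarrow> tiling_by R (tile_mset S) S'"

definition juxtapose ::
  "nat \<Rightarrow> (real \<times> real) set set \<Rightarrow> (real \<times> real) set set \<Rightarrow> (real \<times> real) set set" where
  "juxtapose m' S' S'' = S' \<union> (\<lambda>A. (+) (real m', 0) ` A) ` S''"

definition admits_subtiling :: "nat \<Rightarrow> nat \<Rightarrow> (real \<times> real) set set \<Rightarrow> bool" where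
  "admits_subtiling n m S \<longleftrightarrow>
     (\<exists>m' m'' S' S''. m = m' + m'' \<and> m' \<noteq> 0 \<and> m'' \<noteq> 0 \<and>
        is_tiling (rect n m') S' \<and> is_tiling (rect n m'') S'' \<and>
        rearrangement (rect n m) S (juxtapose m' S' S''))"

text \<open>The infimum of the empty set in \<^typ>\<open>enat\<close> is \<open>\<infinity>\<close>, and natural numbers include \<open>0\<close>.\<close>

definition beta :: "nat \<Rightarrow> (real \<times> real) set set set \<Rightarrow> enat" where
  "beta n \<L> = Inf {enat b | b.
     \<forall>m S. m > b \<longrightarrow> tiling_from (rect n m) \<L> S \<longrightarrow> admits_subtiling n m S}"

definition strongly_noetherian :: "nat \<Rightarrow> (real \<times> real) set set set \<Rightarrow> bool" where
  "strongly_noetherian n \<L> \<longleftrightarrow> beta n \<L> < \<infinity>"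

text \<open>A polyomino may fail to occur in any tiling of a rectangle of height \<open>n\<close>, for instance if it
  is taller than \<open>n\<close>, or if it is shorter than \<open>n\<close> and \<open>\<L>\<close> has nothing to fill the rows beside it.
  Such polyominoes have no influence on \<^term>\<open>beta n \<L>\<close>.\<close>

definition occurs :: "nat \<Rightarrow> (real \<times> real) set set set \<Rightarrow> (real \<times> real) set set \<Rightarrow> bool" where
  "occurs n \<L> P \<longleftrightarrow> (\<exists>m S. tiling_from (rect n m) \<L> S \<and> P \<in># tile_mset S)"

lemma translate_rect:
  "(+) v ` rect h w = {fst v..fst v + real w} \<times> {snd v..snd v + real h}"
proof -
  have "p \<in> (+) v ` rect h w" if "p \<in> {fst v..fst v + real w} \<times> {snd v..snd v + real h}" for p
    using that by (intro image_eqI[of _ _ "p - v"]) (auto simp: rect_def mem_Times_iff)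
  moreover have "v + q \<in> {fst v..fst v + real w} \<times> {snd v..snd v + real h}" if "q \<in> rect h w" for q
    using that by (auto simp: rect_def mem_Times_iff)
  ultimately show ?thesis by blast
qed

lemma shape_rect_inject:
  assumes "shape (rect h w) = shape (rect h' w')"
  shows "h = h'" "w = w'"
proof -
  have "rect h w \<in> shape (rect h w)"
    unfolding shape_def by (rule range_eqI[of _ _ 0]) (simp add: image_iff zero_prod_def[symmetric])
  then obtain v where "rect h w = (+) v ` rect h' w'"
    using assms by (auto simp: shape_def)
  then have "{0..real w} \<times> {0..real h} =
      {fst v..fst v + real w'} \<times> {snd v..snd v + real h'}"
    by (simp only: translate_rect) (simp add: rect_def)
  then show "h = h'" "w = w'" by (auto simp: times_eq_iff Icc_eq_Icc)
qed

lemma height_shape_rect: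
  assumes "h \<ge> 1" "w \<ge> 1" shows "height (shape (rect h w)) = h"
  unfolding height_def using assms by (intro the_equality) (auto dest: shape_rect_inject)

lemma width_shape_rect:
  assumes "h \<ge> 1" "w \<ge> 1" shows "width (shape (rect h w)) = w"
  unfolding width_def using assms by (intro the_equality) (auto dest: shape_rect_inject)

lemma rect_eq_Union_unit_squares:
  assumes "h \<ge> 1" "w \<ge> 1"
  shows "rect h w = (\<Union>c\<in>{0..<int w} \<times> {0..<int h}. unit_square c)"
proof -
  have ex: "\<exists>i\<in>{0..<int k}. real_of_int i \<le> x \<and> x \<le> real_of_int i + 1"
    if "k \<ge> 1" "0 \<le> x" "x \<le> real k" for k :: nat and x :: real
  proof (cases "x = real k")
    case True
    then show ?thesis using that by (intro bexI[of _ "int k - 1"]) auto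
  next
    case False
    then show ?thesis using that by (intro bexI[of _ "\<lfloor>x\<rfloor>"]) (auto simp: floor_less_iff)
  qed
  have "rect h w \<subseteq> (\<Union>c\<in>{0..<int w} \<times> {0..<int h}. unit_square c)"
  proof
    fix p assume "p \<in> rect h w"
    then have "0 \<le> fst p" "fst p \<le> real w" "0 \<le> snd p" "snd p \<le> real h"
      by (auto simp: rect_def)
    with ex[OF assms(2), of "fst p"] ex[OF assms(1), of "snd p"] obtain i j
      where "i \<in> {0..<int w}" "real_of_int i \<le> fst p" "fst p \<le> real_of_int i + 1"
        "j \<in> {0..<int h}" "real_of_int j \<le> snd p" "snd p \<le> real_of_int j + 1" by blast
    then show "p \<in> (\<Union>c\<in>{0..<int w} \<times> {0..<int h}. unit_square c)"
      by (intro UN_I[of "(i, j)"]) (auto simp: unit_square_def mem_Times_iff)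
  qed
  moreover have "unit_square (i, j) \<subseteq> rect h w"
    if "i \<in> {0..<int w}" "j \<in> {0..<int h}" for i j
  proof -
    have "real_of_int i + 1 \<le> real w" "real_of_int j + 1 \<le> real h" 
      using that by (auto simp: of_int_add[symmetric] simp del: of_int_add)
    then show ?thesis using that by (auto simp: unit_square_def rect_def)
  qed
  ultimately show ?thesis by blast
qed

lemma edge_connected_box: "edge_connected ({0..<int w} \<times> {0..<int h})"
proof -
  let ?C = "{0..<int w} \<times> {0..<int h}"
  let ?E = "{(a, b). a \<in> ?C \<and> b \<in> ?C \<and> edge_adjacent a b}"
  have sym: "sym (?E\<^sup>*)"
    by (rule sym_rtrancl) (auto simp: sym_def edge_adjacent_def abs_minus_commute)
  have x: "((0, j), (int i, j)) \<in> ?E\<^sup>*" if "int i < int w" "j \<in> {0..<int h}" for i j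
    using that
  proof (induction i)
    case (Suc i)
    then have "((int i, j), (int (Suc i), j)) \<in> ?E" by (auto simp: edge_adjacent_def)
    with Suc show ?case by (auto intro: rtrancl.rtrancl_into_rtrancl)
  qed auto
  have y: "((0, 0), (0, int j)) \<in> ?E\<^sup>*" if "int j < int h" "w > 0" for j
    using that
  proof (induction j)
    case (Suc j)
    then have "((0, int j), (0, int (Suc j))) \<in> ?E" by (auto simp: edge_adjacent_def)
    with Suc show ?case by (auto intro: rtrancl.rtrancl_into_rtrancl)
  qed auto
  have o: "((0, 0), c) \<in> ?E\<^sup>*" if "c \<in> ?C" for c
  proof -
    have "((0, 0), (0, snd c)) \<in> ?E\<^sup>*" using y[of "nat (snd c)"] that by auto
    moreover have "((0, snd c), (fst c, snd c)) \<in> ?E\<^sup>*"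
      using x[of "nat (fst c)" "snd c"] that by auto
    ultimately have "((0, 0), (fst c, snd c)) \<in> ?E\<^sup>*" by (rule rtrancl_trans)
    then show ?thesis by (simp only: prod.collapse)
  qed
  show ?thesis
    unfolding edge_connected_def
    by (intro ballI rtrancl_trans[OF symD[OF sym o] o])
qed

lemma rectangular_imp_polyomino: "rectangular P \<Longrightarrow> polyomino P"
proof -
  assume "rectangular P"
  then obtain h w where hw: "h \<ge> 1" "w \<ge> 1" "P = shape (rect h w)"
    by (auto simp: rectangular_def)
  then show ?thesis
    unfolding polyomino_def using edge_connected_box[of w h]
    by (intro exI[of _ "{0..<int w} \<times> {0..<int h}"]) (simp add: rect_eq_Union_unit_squares)
qed

end

theory Submission imports Defs begin

text \<open>Let \<open>U\<close> be the polyomino of unit height.  Two tiles of height \<open>> n/2\<close> in a rectangle of height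
  \<open>n\<close> share a row, so their horizontal extents do not overlap and their widths sum to at most \<open>m\<close>.
  As all widths, and hence \<open>m\<close>, are multiples of the width of \<open>U\<close>, the tall tiles can be put side by
  side at the bottom, and the rest of the rectangle can be cut into copies of \<open>U\<close>; the area shows that
  these are as many as before.  This rearrangement consists of columns, each as wide as a single tile
  of the tiling, so it splits as soon as \<open>m\<close> exceeds the widths of the tiles.  Conversely, a column
  containing \<open>P\<close> is a tiling of width \<open>width P\<close> that cannot be split.\<close>

section \<open>Tilings of a rectangle by rectangles\<close>

lemma rectangular_cases:
  assumes "rectangular P"
  shows "height P \<ge> 1" "width P \<ge> 1" "P = shape (rect (height P) (width P))"
  using assms by (auto simp: rectangular_def height_shape_rect width_shape_rect)

lemma self_in_shape: "A \<in> shape A"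
  unfolding shape_def by (rule range_eqI[of _ _ 0]) (simp add: zero_prod_def[symmetric])

lemma shape_translate: "shape ((+) v ` A) = shape A"
proof -
  have "(+) u ` A = (+) (u - v) ` (+) v ` A" for u
    by (simp add: image_image algebra_simps)
  moreover have "(+) u ` (+) v ` A = (+) (u + v) ` A" for u
    by (simp add: image_image algebra_simps)
  ultimately show ?thesis unfolding shape_def by (intro equalityI image_subsetI) (blast intro: range_eqI)+
qed

lemma rectangular_tile:
  assumes "rectangular (shape A)"
  obtains a b where
    "A = {a..a + real (width (shape A))} \<times> {b..b + real (height (shape A))}"
proof -
  have "A \<in> shape (rect (height (shape A)) (width (shape A)))"
    using self_in_shape[of A] rectangular_cases(3)[OF assms] by simp
  then obtain v where "A = (+) v ` rect (height (shape A)) (width (shape A))"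
    by (auto simp: shape_def)
  then show ?thesis
    using that[of "fst v" "snd v"] by (simp only: translate_rect)
qed

text \<open>The third hypothesis leaves two intervals at most an endpoint in common. Such overlaps
  are null sets, so the lengths add up.\<close>

lemma measure_Union_intervals:
  fixes a l :: "'i \<Rightarrow> real"
  assumes "finite I" and "\<And>i. i \<in> I \<Longrightarrow> l i \<ge> 0"
    and "\<And>i j. i \<in> I \<Longrightarrow> j \<in> I \<Longrightarrow> i \<noteq> j \<Longrightarrow> min (a i + l i) (a j + l j) \<le> max (a i) (a j)"
  shows "measure lebesgue (\<Union>i\<in>I. {a i..a i + l i}) = (\<Sum>i\<in>I. l i)"
proof -
  have "pairwise (\<lambda>i j. negligible ({a i..a i + l i} \<inter> {a j..a j + l j})) I"
  proof (rule pairwiseI)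
    fix i j assume "i \<in> I" "j \<in> I" "i \<noteq> j"
    then have "{a i..a i + l i} \<inter> {a j..a j + l j} \<subseteq> {max (a i) (a j)}"
      using assms(3)[of i j] by auto
    then show "negligible ({a i..a i + l i} \<inter> {a j..a j + l j})"
      by (rule negligible_subset[OF negligible_sing])
  qed
  then have "measure lebesgue (\<Union>i\<in>I. {a i..a i + l i}) = (\<Sum>i\<in>I. measure lebesgue {a i..a i + l i})"
    using assms(1) by (intro measure_negligible_finite_Union_image) auto
  then show ?thesis using assms(2) by simp
qed

locale rect_tiling =
  fixes n m :: nat and S :: "(real \<times> real) set set"
  assumes tiling: "is_tiling (rect n m) S"
    and rectangular: "A \<in> S \<Longrightarrow> rectangular (shape A)"
begin

definition "wd A = real (width (shape A))"
definition "ht A = real (height (shape A))"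
text \<open>Sizes are integers, but positions are arbitrary reals: tiles are placed by real
  translations and need not lie on the integer lattice.\<close>

definition "left A = (SOME a. \<exists>b. A = {a..a + wd A} \<times> {b..b + ht A})"
definition "bottom A = (SOME b. A = {left A..left A + wd A} \<times> {b..b + ht A})"

lemma finite_tiles: "finite S" and Union_tiles: "\<Union>S = rect n m"
  using tiling by (auto simp: is_tiling_def)

lemma tile_eq:
  assumes "A \<in> S"
  shows "A = {left A..left A + wd A} \<times> {bottom A..bottom A + ht A}"
proof -
  have "\<exists>a b. A = {a..a + wd A} \<times> {b..b + ht A}"
    using rectangular_tile[OF rectangular[OF assms]] unfolding wd_def ht_def by metis
  then have "\<exists>b. A = {left A..left A + wd A} \<times> {b..b + ht A}"
    unfolding left_def by (rule someI_ex)
  then show ?thesis unfolding bottom_def by (rule someI_ex)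
qed

lemma size_pos:
  assumes "A \<in> S" shows "wd A \<ge> 1" "ht A \<ge> 1"
  using rectangular_cases[OF rectangular[OF assms]] by (auto simp: wd_def ht_def)

lemma tile_bounds:
  assumes "A \<in> S"
  shows "0 \<le> left A" "left A + wd A \<le> real m" "0 \<le> bottom A" "bottom A + ht A \<le> real n"
proof -
  have *: "(x, y) \<in> rect n m" if "left A \<le> x" "x \<le> left A + wd A" "bottom A \<le> y" "y \<le> bottom A + ht A"
    for x y
  proof -
    have "(x, y) \<in> A" by (subst tile_eq[OF assms]) (use that in auto)
    then show ?thesis using Union_tiles assms by blast
  qed
  have "(left A, bottom A) \<in> rect n m" "(left A + wd A, bottom A + ht A) \<in> rect n m"
    using size_pos[OF assms] by (auto intro!: *)
  then show "0 \<le> left A" "left A + wd A \<le> real m" "0 \<le> bottom A" "bottom A + ht A \<le> real n"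
    by (auto simp: rect_def)
qed

text \<open>The intersection of two boxes is the product of the intersections of their projections,
  and a product of intervals has empty interior only if one factor does.\<close>

lemma no_overlap:
  assumes "A \<in> S" "B \<in> S" "A \<noteq> B"
  shows "min (left A + wd A) (left B + wd B) \<le> max (left A) (left B) \<or>
    min (bottom A + ht A) (bottom B + ht B) \<le> max (bottom A) (bottom B)"
proof -
  have "A \<inter> B = ({left A..left A + wd A} \<times> {bottom A..bottom A + ht A}) \<inter>
      ({left B..left B + wd B} \<times> {bottom B..bottom B + ht B})"
    using tile_eq assms by auto
  also have "\<dots> = {max (left A) (left B)..min (left A + wd A) (left B + wd B)} \<times>
      {max (bottom A) (bottom B)..min (bottom A + ht A) (bottom B + ht B)}"
    by auto
  finally have "interior ({max (left A) (left B)..min (left A + wd A) (left B + wd B)} \<times>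
      {max (bottom A) (bottom B)..min (bottom A + ht A) (bottom B + ht B)}) = {}"
    using tiling assms unfolding is_tiling_def by metis
  then show ?thesis
    by (auto simp: interior_Times interior_atLeastAtMost_real greaterThanLessThan_empty_iff)
qed

lemma sum_area: "(\<Sum>A\<in>S. ht A * wd A) = real n * real m"
proof -
  have box: "measure lebesgue ({a..a + x} \<times> {b..b + y}) = y * x"
    "{a..a + x} \<times> {b..b + y} \<in> lmeasurable" if "x \<ge> 0" "y \<ge> 0" for a b x y :: real
  proof -
    have eq: "{a..a + x} \<times> {b..b + y} = cbox (a, b) (a + x, b + y)"
      by (simp only: cbox_Pair_eq cbox_interval[symmetric])
    show "measure lebesgue ({a..a + x} \<times> {b..b + y}) = y * x"
      unfolding eq using that by (simp add: content_Pair)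
    show "{a..a + x} \<times> {b..b + y} \<in> lmeasurable"
      unfolding eq by (rule lmeasurable_cbox)
  qed
  have "measure lebesgue (\<Union>S) = (\<Sum>A\<in>S. measure lebesgue A)"
  proof (rule measure_negligible_finite_Union)
    show "A \<in> lmeasurable" if "A \<in> S" for A
      by (subst tile_eq[OF that], rule box(2)) (use size_pos[OF that] in auto)
    show "pairwise (\<lambda>A B. negligible (A \<inter> B)) S"
    proof (rule pairwiseI)
      fix A B assume AB: "A \<in> S" "B \<in> S" "A \<noteq> B"
      \<comment> \<open>Empty interior alone does not give measure zero; for the convex set
        \<open>A \<inter> B\<close> it does.\<close>
      have "convex A" "convex B"
        by (subst tile_eq[OF AB(1)], simp add: convex_Times) (subst tile_eq[OF AB(2)], simp add: convex_Times)
      then show "negligible (A \<inter> B)"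
        using tiling AB unfolding is_tiling_def
        by (simp add: negligible_convex_interior convex_Int del: interior_Int)
    qed
  qed (rule finite_tiles)
  also have "\<dots> = (\<Sum>A\<in>S. ht A * wd A)"
  proof (rule sum.cong[OF refl])
    fix A assume "A \<in> S"
    then show "measure lebesgue A = ht A * wd A"
      using arg_cong[OF tile_eq, of A "measure lebesgue"] box(1)[of "wd A" "ht A" "left A" "bottom A"]
        size_pos[of A] by linarith
  qed
  finally show ?thesis
    using box(1)[of "real m" "real n" 0 0] by (simp add: Union_tiles rect_def)
qed

text \<open>The line at height \<open>n / 2\<close> runs strictly between bottom and top of each of
  these tiles. Hence no two of them are separated vertically, and their horizontal projections
  overlap in at most a point.\<close>

lemma sum_tall_widths: "(\<Sum>A | A \<in> S \<and> ht A > real n / 2. wd A) \<le> real m"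
proof -
  let ?I = "{A \<in> S. ht A > real n / 2}"
  have "min (left A + wd A) (left B + wd B) \<le> max (left A) (left B)"
    if "A \<in> ?I" "B \<in> ?I" "A \<noteq> B" for A B
  proof -
    have "max (bottom A) (bottom B) < min (bottom A + ht A) (bottom B + ht B)"
      using that tile_bounds[of A] tile_bounds[of B] by (auto simp: max_def min_def)
    then show ?thesis using no_overlap[of A B] that by auto
  qed
  then have "measure lebesgue (\<Union>A\<in>?I. {left A..left A + wd A}) = (\<Sum>A\<in>?I. wd A)"
    using finite_tiles by (intro measure_Union_intervals) (auto simp: wd_def)
  moreover have "(\<Union>A\<in>?I. {left A..left A + wd A}) \<subseteq> {0..real m}"
    using tile_bounds by force
  then have "measure lebesgue (\<Union>A\<in>?I. {left A..left A + wd A}) \<le> measure lebesgue {0..real m}"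
    using finite_tiles by (intro measure_mono_fmeasurable sets.finite_UN) auto
  ultimately show ?thesis by simp
qed

text \<open>A horizontal line missing all tile edges cuts the tiles it meets into intervals that tile its
  whole length.\<close>

lemma width_eq_row:
  assumes "n \<ge> 1"
  obtains R where "R \<subseteq> S" "real m = (\<Sum>A\<in>R. wd A)"
proof -
  let ?E = "bottom ` S \<union> (\<lambda>A. bottom A + ht A) ` S"
  have "infinite ({0<..<real n} - ?E)"
    using assms finite_tiles by (intro Diff_infinite_finite) auto
  then obtain y where "y \<in> {0<..<real n} - ?E"
    using infinite_imp_nonempty by blast
  then have y: "0 < y" "y < real n" "y \<notin> ?E" by auto
  let ?R = "{A \<in> S. bottom A < y \<and> y < bottom A + ht A}"
  have "min (left A + wd A) (left B + wd B) \<le> max (left A) (left B)"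
    if "A \<in> ?R" "B \<in> ?R" "A \<noteq> B" for A B
    using that no_overlap[of A B] by auto
  then have "measure lebesgue (\<Union>A\<in>?R. {left A..left A + wd A}) = (\<Sum>A\<in>?R. wd A)"
    using finite_tiles by (intro measure_Union_intervals) (auto simp: wd_def)
  moreover have "(\<Union>A\<in>?R. {left A..left A + wd A}) = {0..real m}"
  proof
    show "(\<Union>A\<in>?R. {left A..left A + wd A}) \<subseteq> {0..real m}"
      using tile_bounds by force
    show "{0..real m} \<subseteq> (\<Union>A\<in>?R. {left A..left A + wd A})"
    proof
      fix x assume "x \<in> {0..real m}"
      then have "(x, y) \<in> \<Union>S" using y by (auto simp: Union_tiles rect_def)
      then obtain A where A: "A \<in> S" "(x, y) \<in> A" by blast
      then have "(x, y) \<in> {left A..left A + wd A} \<times> {bottom A..bottom A + ht A}"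
        using tile_eq[OF A(1)] by blast
      then have "x \<in> {left A..left A + wd A}" "y \<in> {bottom A..bottom A + ht A}" by auto
      moreover have "y \<noteq> bottom A" "y \<noteq> bottom A + ht A" using y A by auto
      ultimately show "x \<in> (\<Union>A\<in>?R. {left A..left A + wd A})" using A by auto
    qed
  qed
  ultimately have "real m = (\<Sum>A\<in>?R. wd A)" by simp
  then show ?thesis by (intro that[of ?R]) auto
qed

end

lemma rectangular_subset_rect:
  assumes "rectangular (shape A)" "A \<subseteq> rect n m"
  shows "height (shape A) \<le> n" "width (shape A) \<le> m"
proof -
  obtain a b where A: "A = {a..a + real (width (shape A))} \<times> {b..b + real (height (shape A))}"
    by (rule rectangular_tile[OF assms(1)])
  have "(a, b) \<in> A" "(a + real (width (shape A)), b + real (height (shape A))) \<in> A"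
    by (subst A, simp)+
  then have "(a, b) \<in> rect n m"
    "(a + real (width (shape A)), b + real (height (shape A))) \<in> rect n m"
    using assms(2) by blast+
  then show "height (shape A) \<le> n" "width (shape A) \<le> m" by (auto simp: rect_def)
qed

section \<open>Gluing tilings\<close>

text \<open>Tilings are sets of tiles, so gluing must not identify a tile of one part with a tile of
  the other. This fact excludes that.\<close>

lemma interior_polyomino_nonempty:
  assumes "polyomino (shape A)" shows "interior A \<noteq> {}"
proof -
  obtain C where C: "C \<noteq> {}" "shape A = shape (\<Union>c\<in>C. unit_square c)"
    using assms by (auto simp: polyomino_def)
  then obtain c v where c: "c \<in> C" and A: "A = (+) v ` (\<Union>c\<in>C. unit_square c)"
    using self_in_shape[of A] by (auto simp: shape_def)
  have "interior (unit_square c) \<subseteq> interior (\<Union>c\<in>C. unit_square c)"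
    using c by (intro interior_mono) auto
  moreover have "interior (unit_square c) \<noteq> {}"
    by (simp add: unit_square_def interior_Times interior_atLeastAtMost_real)
  ultimately show ?thesis by (auto simp: A interior_translation)
qed

lemma tiling_by_translate:
  assumes "tiling_by R T S"
  shows "tiling_by ((+) v ` R) T ((`) ((+) v) ` S)"
proof -
  have S: "finite S" "\<And>A. A \<in> S \<Longrightarrow> polyomino (shape A)" "\<Union>S = R"
    "\<And>A B. A \<in> S \<Longrightarrow> B \<in> S \<Longrightarrow> A \<noteq> B \<Longrightarrow> interior (A \<inter> B) = {}" "tile_mset S = T"
    using assms unfolding tiling_by_def is_tiling_def by blast+
  have inj: "inj_on ((`) ((+) v)) S"
    by (intro inj_onI) (simp add: inj_image_eq_iff)
  have disj: "interior ((+) v ` A \<inter> (+) v ` B) = {}" if "A \<in> S" "B \<in> S" "A \<noteq> B" for A B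
  proof -
    have "(+) v ` A \<inter> (+) v ` B = (+) v ` (A \<inter> B)"
      by (simp add: image_Int inj_def)
    then show ?thesis using S(4)[OF that] by (simp only: interior_translation image_empty)
  qed
  have "is_tiling ((+) v ` R) ((`) ((+) v) ` S)"
    unfolding is_tiling_def
  proof (intro conjI ballI impI)
    show "finite ((`) ((+) v) ` S)" using S(1) by simp
    show "\<Union> ((`) ((+) v) ` S) = (+) v ` R" using S(3) by blast
    show "polyomino (shape A)" if "A \<in> (`) ((+) v) ` S" for A
      using that S(2) shape_translate by (metis imageE)
    show "interior (A \<inter> B) = {}" if "A \<in> (`) ((+) v) ` S" "B \<in> (`) ((+) v) ` S" "A \<noteq> B" for A B
    proof -
      from that(1) obtain A' where A: "A' \<in> S" "A = (+) v ` A'" by (rule imageE)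
      from that(2) obtain B' where B: "B' \<in> S" "B = (+) v ` B'" by (rule imageE)
      have "A' \<noteq> B'" using that(3) A(2) B(2) by blast
      then show ?thesis using disj[OF A(1) B(1)] A(2) B(2) by simp
    qed
  qed
  moreover have "tile_mset ((`) ((+) v) ` S) = T"
    using S(5) unfolding tile_mset_def image_mset_mset_set[OF inj, symmetric]
      image_mset.compositionality o_def shape_translate .
  ultimately show ?thesis by (simp add: tiling_by_def)
qed

lemma tiling_by_Un:
  assumes "tiling_by R1 T1 S1" "tiling_by R2 T2 S2" "interior (R1 \<inter> R2) = {}"
  shows "tiling_by (R1 \<union> R2) (T1 + T2) (S1 \<union> S2)"
proof -
  have 1: "finite S1" "\<And>A. A \<in> S1 \<Longrightarrow> polyomino (shape A)" "\<Union>S1 = R1"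
    "\<And>A B. A \<in> S1 \<Longrightarrow> B \<in> S1 \<Longrightarrow> A \<noteq> B \<Longrightarrow> interior (A \<inter> B) = {}" "tile_mset S1 = T1"
    using assms(1) unfolding tiling_by_def is_tiling_def by blast+
  have 2: "finite S2" "\<And>A. A \<in> S2 \<Longrightarrow> polyomino (shape A)" "\<Union>S2 = R2"
    "\<And>A B. A \<in> S2 \<Longrightarrow> B \<in> S2 \<Longrightarrow> A \<noteq> B \<Longrightarrow> interior (A \<inter> B) = {}" "tile_mset S2 = T2"
    using assms(2) unfolding tiling_by_def is_tiling_def by blast+
  have cross: "interior (A \<inter> B) = {}" if "A \<in> S1" "B \<in> S2" for A B
  proof -
    have "A \<inter> B \<subseteq> R1 \<inter> R2" using that 1(3) 2(3) by blast
    then show ?thesis using interior_mono assms(3) by blast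
  qed
  \<comment> \<open>A common tile is its own intersection with itself and would have empty interior.
    By disjointness the multisets of tiles add up.\<close>
  then have disj: "S1 \<inter> S2 = {}"
    using 1(2) interior_polyomino_nonempty by (metis Int_absorb disjoint_iff)
  have "is_tiling (R1 \<union> R2) (S1 \<union> S2)"
    unfolding is_tiling_def
  proof (intro conjI ballI impI)
    show "finite (S1 \<union> S2)" "\<Union> (S1 \<union> S2) = R1 \<union> R2" using 1 2 by auto
    show "polyomino (shape A)" if "A \<in> S1 \<union> S2" for A using that 1(2) 2(2) by blast
    show "interior (A \<inter> B) = {}" if "A \<in> S1 \<union> S2" "B \<in> S1 \<union> S2" "A \<noteq> B" for A B
      using that 1(4) 2(4) cross by (metis Un_iff inf_commute)
  qed
  moreover have "tile_mset (S1 \<union> S2) = T1 + T2"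
    using disj 1 2 by (auto simp: tile_mset_def mset_set_Union)
  ultimately show ?thesis by (simp add: tiling_by_def)
qed

lemma tiling_by_juxtapose:
  assumes "tiling_by (rect n m') T' S'" "tiling_by (rect n m'') T'' S''"
  shows "tiling_by (rect n (m' + m'')) (T' + T'') (juxtapose m' S' S'')"
proof -
  have tr: "(+) (real m', 0) ` rect n m'' = {real m'..real m' + real m''} \<times> {0..real n}"
    by (simp only: translate_rect) simp
  \<comment> \<open>The parts meet only on a vertical line, written as a degenerate interval so that
    the interior formula for intervals applies.\<close>
  have "rect n m' \<inter> (+) (real m', 0) ` rect n m'' \<subseteq> {real m'..real m'} \<times> UNIV"
    unfolding tr unfolding rect_def by auto
  then have "interior (rect n m' \<inter> (+) (real m', 0) ` rect n m'') \<subseteq> interior ({real m'..real m'} \<times> UNIV)"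
    by (rule interior_mono)
  then have "interior (rect n m' \<inter> (+) (real m', 0) ` rect n m'') = {}"
    by (simp add: interior_Times interior_atLeastAtMost_real del: atLeastAtMost_singleton)
  moreover have "rect n (m' + m'') = rect n m' \<union> (+) (real m', 0) ` rect n m''"
    unfolding tr unfolding rect_def by auto
  ultimately show ?thesis
    using tiling_by_Un[OF assms(1) tiling_by_translate[OF assms(2), of "(real m', 0)"]]
    by (simp add: juxtapose_def)
qed

text \<open>Whether a tiling admits a subtiling depends only on its multiset of tiles, so the
  positions can be forgotten.\<close>

definition tileable :: "(real \<times> real) set \<Rightarrow> (real \<times> real) set set multiset \<Rightarrow> bool" where
  "tileable R T \<longleftrightarrow> (\<exists>S. tiling_by R T S)"

lemma tileable_beside:
  assumes "tileable (rect n m') T'" "tileable (rect n m'') T''"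
  shows "tileable (rect n (m' + m'')) (T' + T'')"
  using assms tiling_by_juxtapose unfolding tileable_def by blast

lemma tileable_above:
  assumes "tileable (rect h' m) T'" "tileable (rect h'' m) T''"
  shows "tileable (rect (h' + h'') m) (T' + T'')"
proof -
  have tr: "(+) (0, real h') ` rect h'' m = {0..real m} \<times> {real h'..real h' + real h''}"
    by (simp only: translate_rect) simp
  have "rect h' m \<inter> (+) (0, real h') ` rect h'' m \<subseteq> UNIV \<times> {real h'..real h'}"
    unfolding tr unfolding rect_def by auto
  then have "interior (rect h' m \<inter> (+) (0, real h') ` rect h'' m) \<subseteq> interior (UNIV \<times> {real h'..real h'})"
    by (rule interior_mono)
  then have "interior (rect h' m \<inter> (+) (0, real h') ` rect h'' m) = {}"
    by (simp add: interior_Times interior_atLeastAtMost_real del: atLeastAtMost_singleton)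
  moreover have "rect (h' + h'') m = rect h' m \<union> (+) (0, real h') ` rect h'' m"
    unfolding tr unfolding rect_def by auto
  ultimately show ?thesis
    using assms tiling_by_Un tiling_by_translate[of "rect h'' m" T'' _ "(0, real h')"]
    unfolding tileable_def by metis
qed

lemma admits_subtiling_if_tileable:
  assumes "m' \<noteq> 0" "m'' \<noteq> 0" "tileable (rect n m') T'" "tileable (rect n m'') T''"
    and "tile_mset S = T' + T''"
  shows "admits_subtiling n (m' + m'') S"
proof -
  obtain S' S'' where S: "tiling_by (rect n m') T' S'" "tiling_by (rect n m'') T'' S''"
    using assms unfolding tileable_def by blast
  show ?thesis
    unfolding admits_subtiling_def rearrangement_def
    using assms(1,2,5) S tiling_by_juxtapose[OF S] by (metis tiling_by_def)
qed

lemma tileable_single: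
  assumes "rectangular P"
  shows "tileable (rect (height P) (width P)) {#P#}"
proof -
  let ?R = "rect (height P) (width P)"
  have P: "P = shape ?R" using rectangular_cases[OF assms] by simp
  have "polyomino (shape ?R)" using rectangular_imp_polyomino[OF assms] P by simp
  then have "is_tiling ?R {?R}" by (simp add: is_tiling_def)
  moreover have "tile_mset {?R} = {#P#}" using P by (simp add: tile_mset_def)
  ultimately show ?thesis unfolding tileable_def tiling_by_def by blast
qed

section \<open>Tilings by columns\<close>

lemma replicate_mset_add: "replicate_mset (i + j) x = replicate_mset i x + replicate_mset j x"
  by (induction i) auto

locale unit_height =
  fixes U :: "(real \<times> real) set set"
  assumes unit: "rectangular U" "height U = 1"
begin

lemma width_unit_pos: "width U > 0"
  using rectangular_cases[OF unit(1)] by simp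

lemma tileable_row: "j \<ge> 1 \<Longrightarrow> tileable (rect 1 (width U * j)) (replicate_mset j U)"
proof (induction j rule: nat_induct_at_least)
  case base
  then show ?case using tileable_single[OF unit(1)] unit(2) by simp
next
  case (Suc j)
  then show ?case
    using tileable_beside[OF tileable_single[OF unit(1), unfolded unit(2)], of "width U * j" "replicate_mset j U"]
    by simp
qed

lemma tileable_block:
  assumes "j \<ge> 1"
  shows "r \<ge> 1 \<Longrightarrow> tileable (rect r (width U * j)) (replicate_mset (r * j) U)"
proof (induction r rule: nat_induct_at_least)
  case base
  then show ?case using tileable_row[OF assms] by simp
next
  case (Suc r)
  then show ?case
    using tileable_above[OF tileable_row[OF assms], of r "replicate_mset (r * j) U"]
    unfolding mult_Suc replicate_mset_add by simp
qed

text \<open>The number of copies of \<open>U\<close> that fill a column of height \<open>n\<close>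
  above \<open>P\<close>. It has this meaning if \<open>height P \<le> n\<close> and
  \<open>width U dvd width P\<close>.\<close>

definition filler :: "nat \<Rightarrow> (real \<times> real) set set \<Rightarrow> nat" where
  "filler n P = (n - height P) * (width P div width U)"

lemma tileable_column:
  assumes "rectangular P" "height P \<le> n" "width U dvd width P"
  shows "tileable (rect n (width P)) (add_mset P (replicate_mset (filler n P) U))"
\<comment> \<open>A tile of full height leaves no rows above it, while a block of copies of
  \<open>U\<close> needs at least one row.\<close>
proof (cases "height P = n")
  case True
  then show ?thesis using tileable_single[OF assms(1)] by (simp add: filler_def)
next
  case False
  have "width P div width U \<ge> 1"
    using assms(3) rectangular_cases(2)[OF assms(1)] width_unit_pos
    by (auto elim!: dvdE)
  then have "tileable (rect (n - height P) (width U * (width P div width U))) (replicate_mset (filler n P) U)"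
    unfolding filler_def using False assms(2) by (intro tileable_block) auto
  then have "tileable (rect (n - height P) (width P)) (replicate_mset (filler n P) U)"
    by (simp only: dvd_mult_div_cancel[OF assms(3)])
  from tileable_above[OF tileable_single[OF assms(1)] this] show ?thesis
    by (simp only: le_add_diff_inverse[OF assms(2)] union_mset_add_mset_left add_0_left)
qed

text \<open>The tiles of an arrangement into columns: one column for each tile of \<open>M\<close>, filled up with
  copies of \<open>U\<close>, and \<open>c\<close> columns consisting of copies of \<open>U\<close> only.\<close>

definition columns ::
  "nat \<Rightarrow> (real \<times> real) set set multiset \<Rightarrow> nat \<Rightarrow> (real \<times> real) set set multiset" where
  "columns n M c = M + replicate_mset ((\<Sum>P\<in>#M. filler n P) + n * c) U"

definition columns_width :: "(real \<times> real) set set multiset \<Rightarrow> nat \<Rightarrow> nat" where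
  "columns_width M c = (\<Sum>P\<in>#M. width P) + width U * c"

lemma columns_add:
  "columns n (add_mset P M) c = add_mset P (replicate_mset (filler n P) U) + columns n M c"
  "columns_width (add_mset P M) c = width P + columns_width M c"
  by (rule multiset_eqI, simp add: columns_def) (simp add: columns_width_def)

lemma columns_Suc:
  "columns n {#} (Suc c) = replicate_mset n U + columns n {#} c"
  "columns_width {#} (Suc c) = width U + columns_width {#} c"
  by (rule multiset_eqI, simp add: columns_def) (simp add: columns_width_def)

text \<open>The empty arrangement is excluded: \<open>rect n 0\<close> is a segment and not the
  empty set, so no tiles at all do not tile it.\<close>

lemma tileable_columns:
  assumes "n \<ge> 1" "\<And>P. P \<in># M \<Longrightarrow> rectangular P \<and> height P \<le> n \<and> width U dvd width P"
    and "M \<noteq> {#} \<or> c \<noteq> 0"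
  shows "tileable (rect n (columns_width M c)) (columns n M c)"
  using assms(2,3)
proof (induction M)
  case empty
  then show ?case using tileable_block[of c n] assms(1) by (simp add: columns_def columns_width_def)
next
  case (add P M)
  have P: "tileable (rect n (width P)) (add_mset P (replicate_mset (filler n P) U))"
    using add.prems(1)[of P] by (intro tileable_column) auto
  show ?case
  proof (cases "M = {#} \<and> c = 0")
    case True
    then show ?thesis using P by (simp add: columns_def columns_width_def)
  next
    case False
    then show ?thesis
      unfolding columns_add using add by (intro tileable_beside[OF P]) auto
  qed
qed

lemma columns_width_pos:
  assumes "\<And>P. P \<in># M \<Longrightarrow> rectangular P" "M \<noteq> {#} \<or> c \<noteq> 0"
  shows "columns_width M c \<noteq> 0"
proof (cases M)
  case empty
  then show ?thesis using assms width_unit_pos by (simp add: columns_width_def)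
next
  case (add P N)
  then show ?thesis using assms(1)[of P] rectangular_cases(2)[of P] by (simp add: columns_width_def)
qed

text \<open>One column is split off: that of a tile of \<open>M\<close> if there is one, otherwise
  one made of copies of \<open>U\<close>. A second column keeps the remaining width
  positive.\<close>

lemma admits_subtiling_columns:
  assumes "n \<ge> 1" "\<And>P. P \<in># M \<Longrightarrow> rectangular P \<and> height P \<le> n \<and> width U dvd width P"
    and "size M + c \<ge> 2" "tile_mset S = columns n M c"
  shows "admits_subtiling n (columns_width M c) S"
proof (cases M)
  case empty
  then obtain d where d: "c = Suc d" "d \<noteq> 0" using assms(3) by (cases c) auto
  have "tileable (rect n (width U)) (replicate_mset n U)"
    using tileable_block[of 1 n] assms(1) by simp
  then show ?thesis
    using tileable_columns[of n "{#}" d] assms(1,4) d empty columns_width_pos[of "{#}" d] width_unit_pos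
    unfolding empty d columns_Suc
    by (intro admits_subtiling_if_tileable) (auto simp: columns_Suc)
next
  case (add P N)
  have P: "tileable (rect n (width P)) (add_mset P (replicate_mset (filler n P) U))" "width P \<noteq> 0"
    using assms(2)[of P] add rectangular_cases(2)[of P] by (auto intro: tileable_column)
  have "N \<noteq> {#} \<or> c \<noteq> 0" using assms(3) add by auto
  moreover have N: "rectangular Q \<and> height Q \<le> n \<and> width U dvd width Q" if "Q \<in># N" for Q
    using assms(2)[of Q] add that by simp
  ultimately have "tileable (rect n (columns_width N c)) (columns n N c)" "columns_width N c \<noteq> 0"
    using tileable_columns[OF assms(1) N] columns_width_pos[of N c] N by blast+
  then show ?thesis
    using assms(4) P unfolding add columns_add by (intro admits_subtiling_if_tileable)
qed

end

section \<open>Reduction of an arbitrary tiling to columns\<close>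

lemma finite_tiling: "tiling_by R T S \<Longrightarrow> finite S"
  by (simp add: tiling_by_def is_tiling_def)

lemma mem_tile_mset:
  assumes "finite S" shows "P \<in># tile_mset S \<longleftrightarrow> (\<exists>A\<in>S. P = shape A)"
  using assms by (auto simp: tile_mset_def)

lemma sum_tile_mset: "(\<Sum>P\<in>#tile_mset S. f P) = (\<Sum>A\<in>S. f (shape A))"
  by (simp add: tile_mset_def sum_unfold_sum_mset image_mset.compositionality o_def)

context unit_height
begin

lemma filler_area:
  assumes "height P \<le> n" "width U dvd width P"
  shows "n * width P = height P * width P + width U * filler n P"
proof -
  have "width U * filler n P = (n - height P) * width P"
    using assms(2) by (simp add: filler_def)
  then show ?thesis
    using assms(1) by (metis add_mult_distrib le_add_diff_inverse)
qed

text \<open>Once the tall tiles have been placed side by side, the number of remaining copies of \<open>U\<close> is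
  forced by the area.\<close>

lemma tile_mset_eq_columns:
  assumes "rect_tiling n m S" and "n \<ge> 1"
    and tile: "\<And>P. P \<in># tile_mset S \<Longrightarrow> width U dvd width P \<and> (P \<noteq> U \<longrightarrow> n < 2 * height P)"
  defines "M \<equiv> filter_mset (\<lambda>P. P \<noteq> U) (tile_mset S)"
  obtains c where "tile_mset S = columns n M c" "m = columns_width M c"
proof -
  interpret rect_tiling n m S by fact
  let ?u = "width U"
  define k where "k = count (tile_mset S) U"
  have T: "tile_mset S = M + replicate_mset k U"
    unfolding M_def k_def
    using multiset_partition[of "tile_mset S" "\<lambda>P. P \<noteq> U"] by (simp add: filter_eq_replicate_mset)
  have mem: "shape A \<in># tile_mset S" if "A \<in> S" for A
    using that mem_tile_mset[OF finite_tiles] by blast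
  have M: "height P \<le> n" "?u dvd width P" "P \<noteq> U" if P: "P \<in># M" for P
  proof -
    from P have "P \<in># tile_mset S" "P \<noteq> U" by (auto simp: M_def)
    then obtain A where A: "A \<in> S" "P = shape A"
      using mem_tile_mset[OF finite_tiles] by blast
    moreover have "A \<subseteq> rect n m" using A Union_tiles by blast
    ultimately show "height P \<le> n"
      using rectangular_subset_rect(1)[OF rectangular] by blast
    show "?u dvd width P" "P \<noteq> U" using tile[of P] \<open>P \<in># tile_mset S\<close> \<open>P \<noteq> U\<close> by auto
  qed
  \<comment> \<open>The widths in \<open>M\<close> become a sum over placed tiles, with copies of
    \<open>U\<close> counted as 0, so that \<open>sum_tall_widths\<close> can bound it.\<close>
  have sum_M: "(\<Sum>A\<in>S. if shape A = U then 0 else width (shape A)) = (\<Sum>P\<in>#M. width P)"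
  proof -
    have "(\<Sum>A\<in>S. if shape A = U then 0 else width (shape A)) =
        (\<Sum>P\<in>#tile_mset S. if P = U then 0 else width P)"
      by (rule sum_tile_mset[symmetric])
    also have "\<dots> = (\<Sum>P\<in>#M. if P = U then 0 else width P)"
      by (simp add: T)
    also have "\<dots> = (\<Sum>P\<in>#M. width P)"
      using M(3) by (intro arg_cong[where f = sum_mset] image_mset_cong) auto
    finally show ?thesis .
  qed
  have "(\<Sum>P\<in>#M. width P) \<le> m"
  proof -
    have "real (\<Sum>P\<in>#M. width P) = (\<Sum>A\<in>S. if shape A = U then 0 else wd A)"
      unfolding sum_M[symmetric] of_nat_sum by (intro sum.cong) (auto simp: wd_def)
    also have "\<dots> = (\<Sum>A | A \<in> S \<and> shape A \<noteq> U. wd A)"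
      using finite_tiles by (intro sum.mono_neutral_cong_right) auto
    also have "\<dots> \<le> (\<Sum>A | A \<in> S \<and> ht A > real n / 2. wd A)"
    proof (rule sum_mono2)
      have "real n / 2 < ht A" if "A \<in> S" "shape A \<noteq> U" for A
      proof -
        have "n < 2 * height (shape A)" using tile[OF mem] that by blast
        then show ?thesis unfolding ht_def by linarith
      qed
      then show "{A. A \<in> S \<and> shape A \<noteq> U} \<subseteq> {A. A \<in> S \<and> ht A > real n / 2}" by blast
    qed (use finite_tiles in \<open>auto simp: wd_def\<close>)
    also have "\<dots> \<le> real m" by (rule sum_tall_widths)
    finally show ?thesis by linarith
  qed
  \<comment> \<open>By \<open>width_eq_row\<close>, \<open>m\<close> is a sum of widths of tiles,
    each a multiple of \<open>?u\<close>.\<close>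
  moreover have "?u dvd m"
  proof -
    obtain R where R: "R \<subseteq> S" "real m = (\<Sum>A\<in>R. wd A)"
      by (rule width_eq_row[OF \<open>n \<ge> 1\<close>])
    have "real m = real (\<Sum>A\<in>R. width (shape A))" unfolding R(2) wd_def by simp
    then have "m = (\<Sum>A\<in>R. width (shape A))" by linarith
    then show ?thesis using R(1) tile mem by (auto intro!: dvd_sum)
  qed
  moreover have "?u dvd (\<Sum>P\<in>#M. width P)"
    using M(2) by (induction M) auto
  \<comment> \<open>The width not taken by the tiles of \<open>M\<close> is cut into
    \<open>c\<close> columns of copies of \<open>U\<close>.\<close>
  ultimately obtain c where "m - (\<Sum>P\<in>#M. width P) = ?u * c"
    using dvd_diff_nat by blast
  then have c: "m = columns_width M c"
    using \<open>(\<Sum>P\<in>#M. width P) \<le> m\<close> by (simp add: columns_width_def)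
  have "real (\<Sum>P\<in>#tile_mset S. height P * width P) = real (n * m)"
    unfolding sum_tile_mset using sum_area by (simp add: ht_def wd_def)
  then have "n * m = (\<Sum>P\<in>#tile_mset S. height P * width P)"
    by linarith
  also have "\<dots> = (\<Sum>P\<in>#M. height P * width P) + ?u * k"
    by (simp add: T unit(2))
  finally have area: "n * m = (\<Sum>P\<in>#M. height P * width P) + ?u * k" .
  \<comment> \<open>The same area is now computed from the columns. Comparing it with
    \<open>area\<close> and cancelling the positive factor \<open>?u\<close> determines
    \<open>k\<close>.\<close>
  have "n * (\<Sum>P\<in>#M. width P) =
      (\<Sum>P\<in>#M. height P * width P) + ?u * (\<Sum>P\<in>#M. filler n P)"
    using M(1,2)
  proof (induction M)
    case (add P M)
    then show ?case
      using filler_area[of P n] by (simp add: distrib_left)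
  qed simp
  then have "n * m = (\<Sum>P\<in>#M. height P * width P) + ?u * ((\<Sum>P\<in>#M. filler n P) + n * c)"
    unfolding c columns_width_def by (simp add: distrib_left)
  then have "k = (\<Sum>P\<in>#M. filler n P) + n * c"
    using area width_unit_pos by simp
  then have "tile_mset S = columns n M c" by (simp add: T columns_def)
  then show ?thesis using c that by blast
qed

end

text \<open>Every tile of a juxtaposition lies, up to translation, in one of its two parts, and both
  are narrower than \<open>P\<close>.\<close>

lemma not_admits_subtiling_if_full_width:
  assumes P: "rectangular P" "P \<in># tile_mset S"
  shows "\<not> admits_subtiling n (width P) S"
proof
  assume "admits_subtiling n (width P) S"
  then obtain m' m'' S' S'' where m: "width P = m' + m''" "m' \<noteq> 0" "m'' \<noteq> 0"
    and S: "is_tiling (rect n m') S'" "is_tiling (rect n m'') S''"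
    and J: "tiling_by (rect n (width P)) (tile_mset S) (juxtapose m' S' S'')"
    unfolding admits_subtiling_def rearrangement_def by auto
  have "tile_mset (juxtapose m' S' S'') = tile_mset S" using J by (simp add: tiling_by_def)
  then obtain A where A: "A \<in> juxtapose m' S' S''" "P = shape A"
    using P(2) mem_tile_mset[OF finite_tiling[OF J]] by metis
  then have "\<exists>B. P = shape B \<and> (B \<in> S' \<or> B \<in> S'')"
    by (auto simp: juxtapose_def shape_translate)
  then obtain B where B: "P = shape B" "B \<in> S' \<or> B \<in> S''" by blast
  moreover have "\<Union>S' = rect n m'" "\<Union>S'' = rect n m''"
    using S by (simp_all add: is_tiling_def)
  ultimately have "B \<subseteq> rect n m' \<or> B \<subseteq> rect n m''" by blast
  then show False
    using rectangular_subset_rect(2)[of B n m'] rectangular_subset_rect(2)[of B n m''] P(1) m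
    unfolding B(1) by linarith
qed

section \<open>Splitting tilings\<close>

text \<open>If the given polyominoes include none of unit height, then \<open>U\<close> is taken to be the unit
  square; it need not belong to \<open>\<L>\<close>.\<close>

locale tall_tiles = unit_height +
  fixes n :: nat and \<L> :: "(real \<times> real) set set set"
  assumes n: "n \<ge> 1"
    and rectangular: "P \<in> \<L> \<Longrightarrow> rectangular P"
    and dvd_width: "P \<in> \<L> \<Longrightarrow> width U dvd width P"
    and tall: "P \<in> \<L> \<Longrightarrow> P \<noteq> U \<Longrightarrow> n < 2 * height P"
begin

lemma tiling_columns:
  assumes "tiling_from (rect n m) \<L> S"
  obtains c where "tile_mset S = columns n (filter_mset (\<lambda>P. P \<noteq> U) (tile_mset S)) c"
    "m = columns_width (filter_mset (\<lambda>P. P \<noteq> U) (tile_mset S)) c"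
    "set_mset (tile_mset S) \<subseteq> \<L>" "\<forall>P\<in>#tile_mset S. height P \<le> n"
proof -
  have T: "is_tiling (rect n m) S" "set_mset (tile_mset S) \<subseteq> \<L>"
    using assms by (auto simp: tiling_from_def tiling_by_def)
  then have fin: "finite S" and Un: "\<Union>S = rect n m" by (auto simp: is_tiling_def)
  have "shape A \<in> \<L>" if "A \<in> S" for A
    using that T(2) mem_tile_mset[OF fin] by blast
  then have rt: "rect_tiling n m S"
    using T(1) rectangular by unfold_locales auto
  have h: "height P \<le> n" if P: "P \<in># tile_mset S" for P
  proof -
    obtain A where A: "A \<in> S" "P = shape A" using P mem_tile_mset[OF fin] by blast
    moreover have "A \<subseteq> rect n m" using A(1) Un by blast
    ultimately show ?thesis
      using rectangular_subset_rect(1)[of A n m] rect_tiling.rectangular[OF rt A(1)] by simp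
  qed
  show ?thesis
    by (rule tile_mset_eq_columns[OF rt n]) (use T(2) dvd_width tall h that in blast)+
qed

text \<open>This makes the column of \<open>P\<close> a tiling by elements of \<open>\<L>\<close>.
  If \<open>U\<close> is not in \<open>\<L>\<close>, no copy of \<open>U\<close> occurs in the
  tiling, so the filler of every tile in it is 0, which forces full height.\<close>

lemma occurs_tall_or_unit:
  assumes P: "P \<in> \<L>" "occurs n \<L> P"
  shows "height P \<le> n" "U \<in> \<L> \<or> height P = n"
proof -
  obtain m S where S: "tiling_from (rect n m) \<L> S" "P \<in># tile_mset S"
    using P(2) by (auto simp: occurs_def)
  let ?M = "filter_mset (\<lambda>P. P \<noteq> U) (tile_mset S)"
  obtain c where c: "tile_mset S = columns n ?M c" "set_mset (tile_mset S) \<subseteq> \<L>"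
    "\<forall>P\<in>#tile_mset S. height P \<le> n"
    by (rule tiling_columns[OF S(1)])
  show "height P \<le> n" using c(3) S(2) by blast
  show "U \<in> \<L> \<or> height P = n"
  proof (cases "U \<in> \<L>")
    case U: False
    then have "count (columns n ?M c) U = 0"
      using c(1,2) by (metis count_inI subsetD)
    then have "(\<Sum>P\<in>#?M. filler n P) = 0" by (simp add: columns_def)
    moreover have "P \<in># ?M" using S(2) U P(1) by auto
    ultimately have "filler n P = 0" by auto
    moreover have "width P div width U \<noteq> 0"
      using dvd_width[OF P(1)] rectangular_cases(2)[OF rectangular[OF P(1)]] by auto
    ultimately have "height P = n"
      using \<open>height P \<le> n\<close> by (simp add: filler_def)
    then show ?thesis ..
  qed simp
qed

lemma tiling_without_subtiling:
  assumes P: "P \<in> \<L>" "occurs n \<L> P"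
  obtains S where "tiling_from (rect n (width P)) \<L> S" "\<not> admits_subtiling n (width P) S"
proof -
  note h = occurs_tall_or_unit[OF P]
  obtain S where S: "tiling_by (rect n (width P)) (add_mset P (replicate_mset (filler n P) U)) S"
    using tileable_column[OF rectangular h(1) dvd_width] P(1) unfolding tileable_def by blast
  \<comment> \<open>Copies of \<open>U\<close> are added only if \<open>U\<close> is available. If
    \<open>P\<close> is \<open>U\<close> itself, the column consists of \<open>n\<close> copies of
    it.\<close>
  have "U \<in> \<L> \<or> filler n P = 0" using h(2) by (auto simp: filler_def)
  then have "tiling_from (rect n (width P)) \<L> S"
    using S P(1) unfolding tiling_from_def by (intro exI[of _ "add_mset P (replicate_mset (filler n P) U)"]) auto
  moreover have "P \<in># tile_mset S" using S by (simp add: tiling_by_def)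
  ultimately show ?thesis
    using that not_admits_subtiling_if_full_width[OF rectangular[OF P(1)]] by blast
qed

lemma tiling_admits_subtiling:
  assumes S: "tiling_from (rect n m) \<L> S"
    and b: "\<And>P. P \<in> \<L> \<Longrightarrow> occurs n \<L> P \<Longrightarrow> width P < m" and m: "m > 0"
  shows "admits_subtiling n m S"
proof -
  define M where "M = filter_mset (\<lambda>P. P \<noteq> U) (tile_mset S)"
  obtain c where c: "tile_mset S = columns n M c" "m = columns_width M c"
    "set_mset (tile_mset S) \<subseteq> \<L>" "\<forall>P\<in>#tile_mset S. height P \<le> n"
    unfolding M_def by (rule tiling_columns[OF S])
  have less: "width P < m" if "P \<in># tile_mset S" for P
    using that b c(3) S unfolding occurs_def by blast
  have M: "P \<in># tile_mset S" if "P \<in># M" for P using that by (simp add: M_def)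
  \<comment> \<open>No column would mean \<open>m = 0\<close>, and a single column is exactly as
    wide as one of its tiles, against \<open>less\<close>.\<close>
  have "size M + c \<ge> 2"
  proof (rule ccontr)
    assume "\<not> size M + c \<ge> 2"
    then consider "M = {#}" "c = 0" | "M = {#}" "c = 1" | "size M = 1" "c = 0"
    proof -
      assume *: "M = {#} \<Longrightarrow> c = 0 \<Longrightarrow> thesis" "M = {#} \<Longrightarrow> c = 1 \<Longrightarrow> thesis"
        "size M = 1 \<Longrightarrow> c = 0 \<Longrightarrow> thesis" and "\<not> 2 \<le> size M + c"
      then have "size M = 0 \<and> c = 0 \<or> size M = 0 \<and> c = 1 \<or> size M = 1 \<and> c = 0" by linarith
      then show thesis using *(1-3) by (metis size_eq_0_iff_empty)
    qed
    then show False
    proof cases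
      case 1
      then show ?thesis using c(2) m by (simp add: columns_width_def)
    next
      case 2
      \<comment> \<open>The only column consists of \<open>n\<close> copies of \<open>U\<close>;
        \<open>n \<ge> 1\<close> ensures that \<open>U\<close> really occurs.\<close>
      then have "U \<in># tile_mset S" "m = width U"
        using c(1,2) n by (simp_all add: columns_def columns_width_def)
      then show ?thesis using less by blast
    next
      case 3
      then obtain P where "M = {#P#}" using size_1_singleton_mset by blast
      then have "P \<in># tile_mset S" "m = width P"
        using M c(2) 3 by (simp_all add: columns_width_def)
      then show ?thesis using less by blast
    qed
  qed
  moreover have "rectangular P \<and> height P \<le> n \<and> width U dvd width P" if "P \<in># M" for P
    using M[OF that] c(3,4) rectangular dvd_width by blast
  ultimately show ?thesis
    using admits_subtiling_columns[OF n _ _ c(1)] c(2) by blast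
qed

text \<open>This identifies the set whose infimum is \<open>beta n \<L>\<close>. An occurring
  \<open>P\<close> wider than \<open>b\<close> has an unsplittable column of width greater than
  \<open>b\<close>; conversely, \<open>m > b\<close> exceeds every occurring width.\<close>

lemma subtiling_bound_iff:
  "(\<forall>m S. m > b \<longrightarrow> tiling_from (rect n m) \<L> S \<longrightarrow> admits_subtiling n m S) \<longleftrightarrow>
   (\<forall>P\<in>\<L>. occurs n \<L> P \<longrightarrow> width P \<le> b)"
proof
  assume *: "\<forall>m S. m > b \<longrightarrow> tiling_from (rect n m) \<L> S \<longrightarrow> admits_subtiling n m S"
  show "\<forall>P\<in>\<L>. occurs n \<L> P \<longrightarrow> width P \<le> b"
    using * tiling_without_subtiling by (metis not_le)
next
  assume "\<forall>P\<in>\<L>. occurs n \<L> P \<longrightarrow> width P \<le> b"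
  then show "\<forall>m S. m > b \<longrightarrow> tiling_from (rect n m) \<L> S \<longrightarrow> admits_subtiling n m S"
    by (intro allI impI tiling_admits_subtiling) auto
qed

lemma beta_eq:
  assumes "finite \<L>"
  shows "beta n \<L> = (SUP P\<in>{P \<in> \<L>. occurs n \<L> P}. enat (width P))" "beta n \<L> < \<infinity>"
proof -
  \<comment> \<open>The element 0 covers the case that no polyomino occurs; it agrees with the
    supremum of the empty set in \<open>enat\<close>.\<close>
  define W where "W = Max (insert 0 (width ` {P \<in> \<L>. occurs n \<L> P}))"
  have fin: "finite (insert 0 (width ` {P \<in> \<L>. occurs n \<L> P}))" using assms by simp
  have W: "(\<forall>P\<in>\<L>. occurs n \<L> P \<longrightarrow> width P \<le> b) \<longleftrightarrow> W \<le> b" for b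
    unfolding W_def using fin by auto
  have "beta n \<L> = Inf {enat b | b. W \<le> b}"
    unfolding beta_def subtiling_bound_iff W ..
  also have "\<dots> = enat W"
    by (intro antisym Inf_lower Inf_greatest) auto
  finally have beta: "beta n \<L> = enat W" .
  then show "beta n \<L> < \<infinity>" by simp
  have "(SUP P\<in>{P \<in> \<L>. occurs n \<L> P}. enat (width P)) = enat W"
  proof (rule antisym)
    show "(SUP P\<in>{P \<in> \<L>. occurs n \<L> P}. enat (width P)) \<le> enat W"
      using W[of W] by (auto intro!: SUP_least)
    have "W \<in> insert 0 (width ` {P \<in> \<L>. occurs n \<L> P})"
      unfolding W_def using fin by (intro Max_in) auto
    then show "enat W \<le> (SUP P\<in>{P \<in> \<L>. occurs n \<L> P}. enat (width P))"
      by (auto simp: zero_enat_def[symmetric] intro: SUP_upper2)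
  qed
  with beta show "beta n \<L> = (SUP P\<in>{P \<in> \<L>. occurs n \<L> P}. enat (width P))" by simp
qed

end

section \<open>Choice of \<open>U\<close> and the value of \<open>beta\<close>\<close>

theorem theorem2p9:
  fixes n :: nat and \<L> :: "(real \<times> real) set set set"
  assumes "n \<ge> 1"
    and "finite \<L>"
    and "\<forall>P\<in>\<L>. rectangular P"
    and "card {P \<in> \<L>. height P = 1} \<le> 1"
    and "\<forall>P\<in>\<L>. height P \<noteq> 1 \<longrightarrow> real (height P) > real n / 2"
    and "\<forall>U\<in>\<L>. height U = 1 \<longrightarrow> width U dvd Gcd (width ` (\<L> - {U}))"
  shows "strongly_noetherian n \<L>
    \<and> beta n \<L> = (SUP P\<in>{P \<in> \<L>. occurs n \<L> P}. enat (width P))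
    \<and> ((\<exists>P\<in>\<L>. occurs n \<L> P \<and> width P = Max (width ` \<L>)) \<longrightarrow>
         beta n \<L> = enat (Max (width ` \<L>)))"
proof -
  have tall: "n < 2 * height P" if "P \<in> \<L>" "height P \<noteq> 1" for P
    using assms(5) that by force
  have "\<exists>U. tall_tiles U n \<L>"
  proof (cases "\<exists>U\<in>\<L>. height U = 1")
    case True
    then obtain U where U: "U \<in> \<L>" "height U = 1" by blast
    \<comment> \<open>Since \<open>\<L>\<close> is finite, the bound on \<open>card\<close> really
      gives uniqueness, so every element other than \<open>U\<close> is tall.\<close>
    have "P = U" if "P \<in> \<L>" "height P = 1" for P
    proof -
      have "P \<in> {P \<in> \<L>. height P = 1}" "U \<in> {P \<in> \<L>. height P = 1}" using that U by auto
      then show ?thesis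
        using assms(2,4) card_le_Suc0_iff_eq[of "{P \<in> \<L>. height P = 1}"] by simp
    qed
    moreover have "width U dvd width P" if "P \<in> \<L>" for P
    proof (cases "P = U")
      case False
      then have "width P \<in> width ` (\<L> - {U})" using that by blast
      then show ?thesis using assms(6) U by (meson Gcd_dvd dvd_trans)
    qed simp
    ultimately have "tall_tiles U n \<L>"
      using assms(1,3) U tall by unfold_locales blast+
    then show ?thesis by blast
  next
    case False
    \<comment> \<open>The width 1 of the unit square divides every width, and all elements of
      \<open>\<L>\<close> are tall because none has height 1.\<close>
    have "rectangular (shape (rect 1 1))"
      unfolding rectangular_def by (intro exI[of _ 1]) simp
    then have "tall_tiles (shape (rect 1 1)) n \<L>"
      using assms(1,3) False tall
      by unfold_locales (auto simp: height_shape_rect width_shape_rect)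
    then show ?thesis by blast
  qed
  then obtain U where "tall_tiles U n \<L>" by blast
  note beta = tall_tiles.beta_eq[OF this assms(2)]
  \<comment> \<open>An occurring polyomino of largest width attains the supremum.\<close>
  have "beta n \<L> = enat (Max (width ` \<L>))"
    if P: "P \<in> \<L>" "occurs n \<L> P" "width P = Max (width ` \<L>)" for P
    unfolding beta(1)
  proof (rule antisym)
    show "(SUP P\<in>{P \<in> \<L>. occurs n \<L> P}. enat (width P)) \<le> enat (Max (width ` \<L>))"
      using assms(2) by (auto intro!: SUP_least)
    show "enat (Max (width ` \<L>)) \<le> (SUP P\<in>{P \<in> \<L>. occurs n \<L> P}. enat (width P))"
      using P by (intro SUP_upper2[of P]) auto
  qed
  then show ?thesis
    using beta unfolding strongly_noetherian_def by blast
qed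

end
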